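(* Let $n\ge2$ and let $G_r$ be the group generated by the transformations $b_1,b_2,s_0,s_1,t_0,t_1$ defined in the context. Then $G_r$ is isomorphic to the direct product $\mathfrak{S}_6\times\mathfrak{S}_2$, where $\mathfrak{S}_k$ denotes the symmetric group of degree $k$.
   Context: Fix $m=(m_1,\dots,m_n)\in\mathbb{N}^n$ and $|M|=m_1+\cdots+m_n$. The transformations act on pairs $(\vec v,x)$, $\vec v={}^t[s,c_0,c_1,c_2,d_0,d_1,d_2,\delta]\in\mathbb{C}^8$, $x=(x_1,\dots,x_n)\in\mathbb{C}^n$, and all fix $\delta$: $s_i$ ($i=0,1$) exchanges $c_i$ and $c_{i+1}$; $t_i$ ($i=0,1$) exchanges $d_i$ and $d_{i+1}$; these fix everything else; $b_1$ sends $(s,c_0,c_1,c_2,d_0,d_1,d_2)$ to $(2s+\delta-c_0-d_1-d_2,\ s+\delta-d_1-d_2,\ c_1,\ c_2,\ d_0,\ s+\delta-c_0-d_2,\ s+\delta-c_0-d_1)$ and fixes $x$; $b_2$ sends $(s,c_0,c_1,c_2,d_0,d_1,d_2)$ to $(2s+\delta-c_0-c_1-c_2,\ s+\delta-c_1-c_2,\ s+\delta-c_0-c_2,\ s+\delta-c_0-c_1,\ d_0,\ d_1,\ d_2)$ and sends $x_i$ to $-m_i\delta-x_i+|M|\delta$ for $1\le i\le n$. The group operation is composition. *)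

theory Defs
  imports
    "HOL-Analysis.Cartesian_Space"
    "HOL-Algebra.Bij"
    "HOL-Algebra.Sym_Groups"
    "HOL-Algebra.Elementary_Groups"
begin

type_synonym 'n point = "(complex ^ 8) \<times> (complex ^ 'n)"

text \<open>
  The column vector \<open>v = (s, c0, c1, c2, d0, d1, d2, \<delta>)\<close> has its entries at the indices
  \<open>1, \<dots>, 8\<close> in this order; in the index type \<open>8\<close> the numeral \<open>8\<close> denotes \<open>0\<close>,
  which is also where the list constructor \<open>vector\<close> puts the eighth entry (see \<open>vector_8\<close>).
\<close>

abbreviation (input) entries ::
  "complex ^ 8 \<Rightarrow>
    complex \<times> complex \<times> complex \<times> complex \<times> complex \<times> complex \<times> complex \<times> complex" where
  "entries v \<equiv> (v $ 1, v $ 2, v $ 3, v $ 4, v $ 5, v $ 6, v $ 7, v $ 8)"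

definition s0 :: "'n point \<Rightarrow> 'n point" where
  "s0 = (\<lambda>(v, x). let (s, c0, c1, c2, d0, d1, d2, \<delta>) = entries v in
     (vector [s, c1, c0, c2, d0, d1, d2, \<delta>], x))"

definition s1 :: "'n point \<Rightarrow> 'n point" where
  "s1 = (\<lambda>(v, x). let (s, c0, c1, c2, d0, d1, d2, \<delta>) = entries v in
     (vector [s, c0, c2, c1, d0, d1, d2, \<delta>], x))"

definition t0 :: "'n point \<Rightarrow> 'n point" where
  "t0 = (\<lambda>(v, x). let (s, c0, c1, c2, d0, d1, d2, \<delta>) = entries v in
     (vector [s, c0, c1, c2, d1, d0, d2, \<delta>], x))"

definition t1 :: "'n point \<Rightarrow> 'n point" where
  "t1 = (\<lambda>(v, x). let (s, c0, c1, c2, d0, d1, d2, \<delta>) = entries v in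
     (vector [s, c0, c1, c2, d0, d2, d1, \<delta>], x))"

definition b1 :: "'n point \<Rightarrow> 'n point" where
  "b1 = (\<lambda>(v, x). let (s, c0, c1, c2, d0, d1, d2, \<delta>) = entries v in
     (vector [2 * s + \<delta> - c0 - d1 - d2,
              s + \<delta> - d1 - d2, c1, c2,
              d0, s + \<delta> - c0 - d2, s + \<delta> - c0 - d1,
              \<delta>],
      x))"

definition b2 :: "nat ^ 'n::finite \<Rightarrow> 'n point \<Rightarrow> 'n point" where
  "b2 m = (\<lambda>(v, x). let (s, c0, c1, c2, d0, d1, d2, \<delta>) = entries v in
     (vector [2 * s + \<delta> - c0 - c1 - c2,
              s + \<delta> - c1 - c2, s + \<delta> - c0 - c2, s + \<delta> - c0 - c1,
              d0, d1, d2,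
              \<delta>],
      \<chi> i. - of_nat (m $ i) * \<delta> - x $ i + of_nat (\<Sum>j\<in>UNIV. m $ j) * \<delta>))"

definition G_r :: "nat ^ 'n::finite \<Rightarrow> ('n point \<Rightarrow> 'n point) monoid" where
  "G_r m = subgroup_generated (BijGroup UNIV) {b1, b2 m, s0, s1, t0, t1}"

lemma vector_8 [simp]:
  fixes a b c d e f g h :: "'a::zero"
  defines "v \<equiv> (vector [a, b, c, d, e, f, g, h] :: 'a ^ 8)"
  shows "v $ 1 = a" "v $ 2 = b" "v $ 3 = c" "v $ 4 = d"
        "v $ 5 = e" "v $ 6 = f" "v $ 7 = g" "v $ 8 = h"
  unfolding v_def vector_def by simp_all

lemma forall_8: "(\<forall>i::8. P i) \<longleftrightarrow>
    P 1 \<and> P 2 \<and> P 3 \<and> P 4 \<and> P 5 \<and> P 6 \<and> P 7 \<and> P 8"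
proof -
  have "i = 1 \<or> i = 2 \<or> i = 3 \<or> i = 4 \<or> i = 5 \<or> i = 6 \<or> i = 7 \<or> i = 8" for i :: 8
  proof (induct i)
    case (of_int z)
    then have "0 \<le> z" "z < 8" by simp_all
    then have "z = 0 \<or> z = 1 \<or> z = 2 \<or> z = 3 \<or> z = 4 \<or> z = 5 \<or> z = 6 \<or> z = 7" by arith
    then show ?case by auto
  qed
  then show ?thesis by metis
qed

text \<open>
  \<open>subgroup_generated G S\<close> silently discards the elements of \<open>S\<close> outside the carrier;
  all six generators are involutions, so nothing is discarded in \<open>G_r\<close>.
\<close>

lemma generators_involutive:
  fixes p :: "'n::finite point"
  shows "s0 (s0 p) = p" "s1 (s1 p) = p" "t0 (t0 p) = p" "t1 (t1 p) = p"
        "b1 (b1 p) = p" "b2 m (b2 m p) = p"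
  by (cases p; simp add: s0_def s1_def t0_def t1_def b1_def b2_def vec_eq_iff forall_8)+

lemma generators_in_carrier:
  "{b1, b2 m, s0, s1, t0, t1} \<subseteq> carrier (BijGroup (UNIV :: 'n::finite point set))"
proof -
  have "f \<in> carrier (BijGroup UNIV)" if "\<And>p. f (f p) = p" for f :: "'n point \<Rightarrow> 'n point"
    using that by (auto simp: BijGroup_def Bij_def intro: involuntory_imp_bij)
  then show ?thesis by (simp add: generators_involutive)
qed

end

theory Submission
  imports Defs
begin

text \<open>
  The group is made visible by a linear change of coordinates on the space of pairs \<open>(v, x)\<close>.
  Put \<open>u = s + \<delta> - c0 - c1 - c2\<close> and \<open>\<xi>\<^sub>i = x\<^sub>i - (|M| - m\<^sub>i) \<delta> / 2\<close>, and consider the six functionals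
  \<open>-c2\<close>, \<open>-c1\<close>, \<open>-c0\<close>, \<open>d1 + d2 - s - \<delta>\<close>, \<open>d0 + d2 - s - \<delta>\<close>, \<open>d0 + d1 - s - \<delta>\<close>, each shifted
  by \<open>-u / 2\<close>. Together with \<open>u\<close>, \<open>\<delta>\<close> and \<open>\<xi>\<close> these six functionals form a coordinate system.
  In it the generators \<open>s1\<close>, \<open>s0\<close>, \<open>b1\<close>, \<open>t0\<close>, \<open>t1\<close> are the five
  adjacent transpositions of the six functionals (the nodes of a Dynkin diagram of type \<open>A\<^sub>5\<close>, in
  this order) and fix \<open>u\<close>, \<open>\<delta>\<close>, \<open>\<xi>\<close>, whereas \<open>b2\<close> fixes the six functionals and \<open>\<delta>\<close> and
  negates \<open>u\<close> and \<open>\<xi>\<close>.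

  Hence \<open>S\<^sub>6 \<times> S\<^sub>2\<close> acts on the space, the first factor by permuting the six functionals and the second
  by its sign on \<open>u\<close> and \<open>\<xi>\<close>. The action is faithful, as one sees on a point at which
  the six functionals take distinct values and \<open>u \<noteq> 0\<close>. Adjacent transpositions generate a
  symmetric group, so the image of the action is the group generated by the six given
  transformations.
\<close>

section \<open>Generators of symmetric groups and of direct products\<close>

lemma sym_group_generated_by_adjacent_transpositions:
  "generate (sym_group n) ((\<lambda>i. Transposition.transpose i (Suc i)) ` {1..<n})
     = carrier (sym_group n)"
  (is "generate ?G ?T = _")
proof
  interpret group ?G by (rule sym_group_is_group)
  have "?T \<subseteq> carrier ?G"
    by (auto simp: sym_group_carrier intro!: permutes_swap_id)
  then show "generate ?G ?T \<subseteq> carrier ?G"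
    by (rule generate_incl)
  have comp: "p \<circ> q \<in> generate ?G ?T"
    if "p \<in> generate ?G ?T" "q \<in> generate ?G ?T" for p q
    using generate.eng[OF that] by (simp add: sym_group_mult)
  have id_gen: "id \<in> generate ?G ?T"
    using generate.one[of ?G ?T] by (simp add: sym_group_one)
  have word: "apply_adj_transps is \<in> generate ?G ?T" if "set is \<subseteq> {1..<n}" for "is"
    using that
  proof (induction "is")
    case Nil
    show ?case unfolding apply_adj_transps_Nil by (rule id_gen)
  next
    case (Cons i "is")
    then show ?case
      unfolding apply_adj_transps_Cons by (intro comp) (auto intro: generate.incl)
  qed
  have ordered: "Transposition.transpose a b \<in> generate ?G ?T"
    if "a \<in> {1..n}" "b \<in> {1..n}" "a < b" for a b
    using word[of "adj_transp_seq a b"] that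
    by (simp add: adj_transp_seq_correct set_adj_transp_seq)
  have transp: "Transposition.transpose a b \<in> generate ?G ?T"
    if "a \<in> {1..n}" "b \<in> {1..n}" "a \<noteq> b" for a b
    using ordered[of a b] ordered[of b a] that
    by (cases "a < b") (auto simp: Transposition.transpose_commute)
  show "carrier ?G \<subseteq> generate ?G ?T"
  proof
    fix p assume "p \<in> carrier ?G"
    then have "p permutes {1..n}" by (simp add: sym_group_carrier)
    then show "p \<in> generate ?G ?T"
      using finite_atLeastAtMost
    proof (induction rule: permutes_induct)
      case id
      show ?case by (rule id_gen)
    next
      case (swap a b p)
      then show ?case by (intro comp transp)
    qed
  qed
qed

lemma generate_DirProd:
  assumes "group G" "group H"
    and A: "A \<subseteq> carrier G" "generate G A = carrier G"
    and B: "B \<subseteq> carrier H" "generate H B = carrier H"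
  shows "generate (G \<times>\<times> H) ((\<lambda>a. (a, \<one>\<^bsub>H\<^esub>)) ` A \<union> (\<lambda>b. (\<one>\<^bsub>G\<^esub>, b)) ` B) = carrier (G \<times>\<times> H)"
    (is "generate ?P (?A \<union> ?B) = _")
proof
  interpret G: group G by fact
  interpret H: group H by fact
  interpret P: group ?P by (rule DirProd_group) fact+
  interpret inl: group_hom G ?P "\<lambda>a. (a, \<one>\<^bsub>H\<^esub>)"
    by unfold_locales (auto simp: hom_def)
  interpret inr: group_hom H ?P "\<lambda>b. (\<one>\<^bsub>G\<^esub>, b)"
    by unfold_locales (auto simp: hom_def)
  show "generate ?P (?A \<union> ?B) \<subseteq> carrier ?P"
    using A B by (intro P.generate_incl) auto
  show "carrier ?P \<subseteq> generate ?P (?A \<union> ?B)"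
  proof clarify
    fix a b assume "(a, b) \<in> carrier ?P"
    then have ab: "a \<in> carrier G" "b \<in> carrier H" by auto
    have "(a, \<one>\<^bsub>H\<^esub>) \<in> generate ?P ?A" "(\<one>\<^bsub>G\<^esub>, b) \<in> generate ?P ?B"
      using ab A B by (auto simp: inl.generate_img inr.generate_img)
    then have "(a, \<one>\<^bsub>H\<^esub>) \<in> generate ?P (?A \<union> ?B)" "(\<one>\<^bsub>G\<^esub>, b) \<in> generate ?P (?A \<union> ?B)"
      using P.mono_generate[of ?A "?A \<union> ?B"] P.mono_generate[of ?B "?A \<union> ?B"] by auto
    then have "(a, \<one>\<^bsub>H\<^esub>) \<otimes>\<^bsub>?P\<^esub> (\<one>\<^bsub>G\<^esub>, b) \<in> generate ?P (?A \<union> ?B)"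
      by (rule generate.eng)
    then show "(a, b) \<in> generate ?P (?A \<union> ?B)"
      using ab by simp
  qed
qed

lemma (in group_hom) iso_subgroup_generated_image:
  assumes "inj_on h (carrier G)" "S \<subseteq> carrier G" "generate G S = carrier G"
  shows "h \<in> iso G (subgroup_generated H (h ` S))"
proof -
  have "h ` S \<subseteq> carrier H"
    using assms(2) by auto
  then have "carrier (subgroup_generated H (h ` S)) = h ` carrier G"
    using assms by (simp add: carrier_subgroup_generated Int_absorb1 generate_img)
  then show ?thesis
    using assms(1) homh by (auto simp: Group.iso_iff hom_def)
qed

section \<open>Adapted coordinates\<close>

text \<open>
  The transformation \<open>b2\<close> adds this quantity to each of \<open>s\<close>, \<open>c0\<close>, \<open>c1\<close>, \<open>c2\<close>, so its vanishing
  characterises the vectors that \<open>b2\<close> fixes.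
\<close>

definition balance :: "'n point \<Rightarrow> complex" where
  "balance = (\<lambda>(v, x). let (s, c0, c1, c2, d0, d1, d2, \<delta>) = entries v in
     s + \<delta> - c0 - c1 - c2)"

text \<open>
  The functionals are listed in the order in which they sit on the \<open>A\<^sub>5\<close> diagram. Their
  shift by half the balance makes them invariant under \<open>b2\<close>, which adds \<open>-u\<close> to each of the
  unshifted functionals while replacing \<open>u\<close> by \<open>-u\<close>. Indices outside
  \<open>{1..6}\<close> carry no coordinate.
\<close>

definition weight :: "'n point \<Rightarrow> nat \<Rightarrow> complex" where
  "weight = (\<lambda>(v, x) i. let (s, c0, c1, c2, d0, d1, d2, \<delta>) = entries v in
     (if i = 1 then - c2
      else if i = 2 then - c1
      else if i = 3 then - c0
      else if i = 4 then d1 + d2 - s - \<delta>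
      else if i = 5 then d0 + d2 - s - \<delta>
      else d0 + d1 - s - \<delta>) - balance (v, x) / 2)"

text \<open>
  For a given \<open>\<delta>\<close>, \<open>b2\<close> acts on \<open>x\<close> by the reflection in this point; translating it to
  the origin turns the affine map into negation.
\<close>

definition b2_centre :: "nat ^ 'n::finite \<Rightarrow> complex \<Rightarrow> complex ^ 'n" where
  "b2_centre m \<delta> = (\<chi> i. (of_nat (\<Sum>j\<in>UNIV. m $ j) - of_nat (m $ i)) * \<delta> / 2)"

text \<open>
  The inverse of the coordinate map. In the coordinates of a point, \<open>W = - c0 - c1 - c2 - 3 u / 2\<close>,
  and subtracting \<open>W\<close> from the weights \<open>4, 5, 6\<close> leaves \<open>d1 + d2\<close>, \<open>d0 + d2\<close>, \<open>d0 + d1\<close>.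
\<close>

definition from_coords ::
  "nat ^ 'n::finite \<Rightarrow> (nat \<Rightarrow> complex) \<Rightarrow> complex \<Rightarrow> complex \<Rightarrow> complex ^ 'n \<Rightarrow> 'n point" where
  "from_coords m w u \<delta> \<xi> = (let W = w 1 + w 2 + w 3 in
     (vector [- \<delta> - W - u / 2,
              - w 3 - u / 2, - w 2 - u / 2, - w 1 - u / 2,
              (w 5 + w 6 - w 4 - W) / 2, (w 4 + w 6 - w 5 - W) / 2, (w 4 + w 5 - w 6 - W) / 2,
              \<delta>],
      \<xi> + b2_centre m \<delta>))"

lemma from_coords_of_point:
  "from_coords m (weight p) (balance p) (fst p $ 8) (snd p - b2_centre m (fst p $ 8)) = p"
  by (cases p)
    (simp add: from_coords_def weight_def balance_def Let_def vec_eq_iff forall_8 field_simps)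

lemma
  shows balance_from_coords [simp]: "balance (from_coords m w u \<delta> \<xi>) = u"
    and fst_from_coords_8 [simp]: "fst (from_coords m w u \<delta> \<xi>) $ 8 = \<delta>"
    and snd_from_coords [simp]: "snd (from_coords m w u \<delta> \<xi>) = \<xi> + b2_centre m \<delta>"
  by (simp_all add: from_coords_def balance_def Let_def field_simps)

lemma weight_from_coords [simp]:
  assumes "i \<in> {1..6}"
  shows "weight (from_coords m w u \<delta> \<xi>) i = w i"
proof -
  have "i \<in> {1, 2, 3, 4, 5, 6}" using assms by auto
  then show ?thesis
    by (auto simp: from_coords_def weight_def balance_def Let_def field_simps)
qed

lemma from_coords_cong:
  assumes "\<And>i. i \<in> {1..6} \<Longrightarrow> w i = w' i"
  shows "from_coords m w u \<delta> \<xi> = from_coords m w' u \<delta> \<xi>"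
  by (simp add: from_coords_def assms)

section \<open>The action of \<open>S\<^sub>6 \<times> S\<^sub>2\<close>\<close>

text \<open>
  The permutation enters through its inverse so that composition of permutations becomes
  composition of transformations in the same order.
\<close>

definition coord_action ::
  "nat ^ 'n::finite \<Rightarrow> (nat \<Rightarrow> nat) \<times> (nat \<Rightarrow> nat) \<Rightarrow> 'n point \<Rightarrow> 'n point" where
  "coord_action m = (\<lambda>(\<sigma>, \<tau>) p.
     from_coords m (weight p \<circ> inv' \<sigma>) (of_int (sign \<tau>) * balance p) (fst p $ 8)
       (of_int (sign \<tau>) *s (snd p - b2_centre m (fst p $ 8))))"

lemma coord_action_id: "coord_action m (id, id) = id"
  by (simp add: fun_eq_iff coord_action_def from_coords_of_point)

lemma coord_action_comp:
  assumes "\<sigma> permutes {1..6}" "\<sigma>' permutes {1..6}" "permutation \<tau>" "permutation \<tau>'"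
  shows "coord_action m (\<sigma> \<circ> \<sigma>', \<tau> \<circ> \<tau>') = coord_action m (\<sigma>, \<tau>) \<circ> coord_action m (\<sigma>', \<tau>')"
proof
  fix p
  define q where "q = coord_action m (\<sigma>', \<tau>') p"
  have q: "balance q = of_int (sign \<tau>') * balance p" "fst q $ 8 = fst p $ 8"
    "snd q - b2_centre m (fst q $ 8) = of_int (sign \<tau>') *s (snd p - b2_centre m (fst p $ 8))"
    by (simp_all add: q_def coord_action_def)
  have "inv' \<sigma> i \<in> {1..6}" if "i \<in> {1..6}" for i
    using that permutes_in_image[OF permutes_inv[OF assms(1)]] by blast
  then have weight_q: "weight q (inv' \<sigma> i) = weight p (inv' \<sigma>' (inv' \<sigma> i))" if "i \<in> {1..6}" for i
    using that by (simp add: q_def coord_action_def)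
  have inv: "inv' (\<sigma> \<circ> \<sigma>') = inv' \<sigma>' \<circ> inv' \<sigma>"
    using assms(1,2) by (simp add: o_inv_distrib permutes_bij)
  have sign: "complex_of_int (sign (\<tau> \<circ> \<tau>')) = of_int (sign \<tau>) * of_int (sign \<tau>')"
    using sign_compose[OF assms(3,4)] by simp
  have "coord_action m (\<sigma>, \<tau>) q = from_coords m (weight q \<circ> inv' \<sigma>)
      (of_int (sign (\<tau> \<circ> \<tau>')) * balance p) (fst p $ 8)
      (of_int (sign (\<tau> \<circ> \<tau>')) *s (snd p - b2_centre m (fst p $ 8)))"
    unfolding coord_action_def prod.case q(3)
    by (simp only: q(1,2) sign mult.assoc vector_smult_assoc)
  also have "\<dots> = coord_action m (\<sigma> \<circ> \<sigma>', \<tau> \<circ> \<tau>') p"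
    unfolding coord_action_def prod.case inv by (rule from_coords_cong) (simp add: weight_q)
  finally show "coord_action m (\<sigma> \<circ> \<sigma>', \<tau> \<circ> \<tau>') p
      = (coord_action m (\<sigma>, \<tau>) \<circ> coord_action m (\<sigma>', \<tau>')) p"
    by (simp add: q_def)
qed

lemma coord_action_bij:
  assumes "\<sigma> permutes {1..6}" "permutation \<tau>"
  shows "bij (coord_action m (\<sigma>, \<tau>))"
proof (rule o_bij)
  have \<tau>: "bij \<tau>" "permutation (inv' \<tau>)"
    using assms(2) by (auto intro: permutation_bijective permutation_inverse)
  show "coord_action m (inv' \<sigma>, inv' \<tau>) \<circ> coord_action m (\<sigma>, \<tau>) = id"
    using coord_action_comp[of "inv' \<sigma>" \<sigma> "inv' \<tau>" \<tau> m] assms \<tau>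
    by (simp add: permutes_inv permutes_inv_o coord_action_id bij_is_inj)
  show "coord_action m (\<sigma>, \<tau>) \<circ> coord_action m (inv' \<sigma>, inv' \<tau>) = id"
    using coord_action_comp[of \<sigma> "inv' \<sigma>" \<tau> "inv' \<tau>" m] assms \<tau>
    by (simp add: permutes_inv permutes_inv_o coord_action_id bij_is_surj surj_iff[THEN iffD1])
qed

lemma group_hom_coord_action:
  "group_hom (sym_group 6 \<times>\<times> sym_group 2) (BijGroup UNIV) (coord_action m)"
proof -
  have Bij: "coord_action m (\<sigma>, \<tau>) \<in> Bij UNIV"
    if "\<sigma> permutes {1..6}" "\<tau> permutes {1..2}" for \<sigma> \<tau>
    using coord_action_bij[OF that(1)] that(2)
    by (auto simp: Bij_def intro: permutes_imp_permutation)
  have "coord_action m \<in> hom (sym_group 6 \<times>\<times> sym_group 2) (BijGroup UNIV)"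
  proof (rule homI)
    fix g assume "g \<in> carrier (sym_group 6 \<times>\<times> sym_group 2)"
    then show "coord_action m g \<in> carrier (BijGroup UNIV)"
      by (auto simp: BijGroup_def sym_group_carrier Bij)
  next
    fix g h
    assume gh: "g \<in> carrier (sym_group 6 \<times>\<times> sym_group 2)"
      "h \<in> carrier (sym_group 6 \<times>\<times> sym_group 2)"
    obtain \<sigma> \<tau> \<sigma>' \<tau>' where [simp]: "g = (\<sigma>, \<tau>)" "h = (\<sigma>', \<tau>')"
      by (cases g, cases h)
    from gh show "coord_action m (g \<otimes>\<^bsub>sym_group 6 \<times>\<times> sym_group 2\<^esub> h)
        = coord_action m g \<otimes>\<^bsub>BijGroup UNIV\<^esub> coord_action m h"
      by (simp add: sym_group_carrier sym_group_mult BijGroup_def Bij coord_action_comp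
          permutes_imp_permutation[of "{1..2}"] compose_def fun_eq_iff
          flip: One_nat_def)
  qed
  then show ?thesis
    by (simp add: group_hom_def group_hom_axioms_def DirProd_group sym_group_is_group
        group_BijGroup)
qed

text \<open>
  The point with weights \<open>1, \<dots>, 6\<close> and balance \<open>1\<close> has trivial stabiliser: its weights recover
  the first component of a group element, and its balance recovers the sign of the second, which
  determines an element of \<open>S\<^sub>2\<close>.
\<close>

lemma inj_on_coord_action:
  "inj_on (coord_action m) (carrier (sym_group 6 \<times>\<times> sym_group 2))"
proof (rule inj_onI, clarify)
  fix \<sigma> \<tau> \<sigma>' \<tau>' :: "nat \<Rightarrow> nat"
  assume "(\<sigma>, \<tau>) \<in> carrier (sym_group 6 \<times>\<times> sym_group 2)"
    "(\<sigma>', \<tau>') \<in> carrier (sym_group 6 \<times>\<times> sym_group 2)"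
  then have \<sigma>: "\<sigma> permutes {1..6}" "\<sigma>' permutes {1..6}"
    and "\<tau> permutes {1..2}" "\<tau>' permutes {1..2}"
    by (auto simp: sym_group_carrier)
  moreover have "{1..2} = {1, 2 :: nat}" by auto
  ultimately have \<tau>: "\<tau> = id \<or> \<tau> = Transposition.transpose 1 2"
    "\<tau>' = id \<or> \<tau>' = Transposition.transpose 1 2"
    by (simp_all add: permutes_doubleton_iff)
  assume eq: "coord_action m (\<sigma>, \<tau>) = coord_action m (\<sigma>', \<tau>')"
  define p where "p = from_coords m of_nat 1 0 0"
  have "inv' \<sigma> i = inv' \<sigma>' i" for i
  proof (cases "i \<in> {1..6}")
    case True
    then have "inv' \<sigma> i \<in> {1..6}" "inv' \<sigma>' i \<in> {1..6}"
      using \<sigma> by (metis permutes_in_image permutes_inv)+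
    moreover have "weight (coord_action m (\<sigma>, \<tau>) p) i = weight (coord_action m (\<sigma>', \<tau>') p) i"
      by (simp add: eq)
    ultimately show ?thesis
      using True by (simp add: coord_action_def p_def)
  next
    case False
    then show ?thesis
      using \<sigma> by (metis permutes_inv permutes_not_in)
  qed
  then have "inv' \<sigma> = inv' \<sigma>'" by (simp add: fun_eq_iff)
  then have "\<sigma> = \<sigma>'" using \<sigma> by (metis permutes_inv_inv)
  moreover have "balance (coord_action m (\<sigma>, \<tau>) p) = balance (coord_action m (\<sigma>', \<tau>') p)"
    by (simp add: eq)
  then have "sign \<tau> = sign \<tau>'" by (simp add: coord_action_def p_def)
  then have "\<tau> = \<tau>'" using \<tau> by (auto simp: sign_swap_id)
  ultimately show "\<sigma> = \<sigma>' \<and> \<tau> = \<tau>'" by simp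
qed

section \<open>The generators in adapted coordinates\<close>

text \<open>
  The functionals were chosen for the third of these identities. The \<open>c\<close> triple \<open>-c2, -c1, -c0\<close>
  and the \<open>d\<close> triple \<open>D - d0, D - d1, D - d2\<close>, \<open>D = d0 + d1 + d2 - s - \<delta>\<close>, are permuted in the
  evident way by \<open>s0, s1\<close> and by \<open>t0, t1\<close>; and \<open>b1\<close> sends \<open>-c0\<close> to
  \<open>d1 + d2 - s - \<delta> = D - d0\<close>, which links the two triples into one chain of six; \<open>b1\<close> fixes the other four
  functionals and \<open>u\<close>.
\<close>

lemma
  shows coord_action_s1: "coord_action m (Transposition.transpose 1 2, id) = s1"
    and coord_action_s0: "coord_action m (Transposition.transpose 2 3, id) = s0"
    and coord_action_b1: "coord_action m (Transposition.transpose 3 4, id) = b1"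
    and coord_action_t0: "coord_action m (Transposition.transpose 4 5, id) = t0"
    and coord_action_t1: "coord_action m (Transposition.transpose 5 6, id) = t1"
  by (simp_all add: fun_eq_iff coord_action_def from_coords_def weight_def balance_def Let_def
      s0_def s1_def b1_def t0_def t1_def Transposition.transpose_def vec_eq_iff forall_8 field_simps)

lemma coord_action_b2: "coord_action m (id, Transposition.transpose 1 2) = b2 m"
  by (simp add: fun_eq_iff coord_action_def from_coords_def weight_def balance_def Let_def
      b2_def b2_centre_def sign_swap_id vec_eq_iff forall_8 field_simps)

theorem proposition3p3:
  fixes m :: "nat ^ 'n::finite"
  assumes "CARD('n) \<ge> 2"
  shows "G_r m \<cong> sym_group 6 \<times>\<times> sym_group 2"
proof -
  let ?P = "sym_group 6 \<times>\<times> sym_group 2"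
  let ?adj = "\<lambda>n. (\<lambda>i. Transposition.transpose i (Suc i)) ` {1..<n}"
  let ?S = "(\<lambda>\<sigma>. (\<sigma>, id)) ` ?adj 6 \<union> (\<lambda>\<tau>. (id, \<tau>)) ` ?adj 2"
  interpret group_hom ?P "BijGroup UNIV" "coord_action m"
    by (rule group_hom_coord_action)
  have adj: "?adj n \<subseteq> carrier (sym_group n)" for n
    by (auto simp: sym_group_carrier intro!: permutes_swap_id)
  have "{1..<6} = {1, 2, 3, 4, 5 :: nat}" "{1..<2} = {1 :: nat}" by auto
  then have image: "coord_action m ` ?S = {b1, b2 m, s0, s1, t0, t1}"
    using coord_action_s1[of m] coord_action_s0[of m] coord_action_b1[of m]
      coord_action_t0[of m] coord_action_t1[of m] coord_action_b2[of m]
    by (auto simp: numeral_eq_Suc)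
  have "generate ?P ?S = carrier ?P"
    using generate_DirProd[OF sym_group_is_group sym_group_is_group
        adj sym_group_generated_by_adjacent_transpositions
        adj sym_group_generated_by_adjacent_transpositions]
    by (simp add: sym_group_one)
  moreover have "?S \<subseteq> carrier ?P"
    using adj[of 6] adj[of 2] by (auto simp: sym_group_carrier permutes_id)
  ultimately have "coord_action m \<in> iso ?P (G_r m)"
    unfolding G_r_def image[symmetric]
    by (intro iso_subgroup_generated_image inj_on_coord_action)
  then have "?P \<cong> G_r m" by (rule is_isoI)
  then show ?thesis by (rule G.iso_sym)
qed

end
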